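(* Let $(X,\trianglelefteq)$ be a parallel ordered locale whose localic cones preserve joins. The causal coverage $\mathrm{Cov}^-_{\trianglelefteq}$ defines a $\Downarrow$-Grothendieck topology $J^-$ on the category $\mathcal{O}X$ as follows: for $U\in\mathcal{O}X$ and a sieve $R$ on $\Downarrow U$, $$R\in J^-(U)\quad\text{if and only if}\quad \bigvee R\in\mathrm{Cov}^-_{\trianglelefteq}(U),$$ where $\bigvee R$ denotes the join of the domains of the arrows in $R$.
   Context: A locale $X$ is given by its frame of opens $\mathcal{O}X$ with order $\sqsubseteq$, finite meets $\wedge$, joins $\bigvee$, bottom element $\varnothing$. An ordered locale $(X,\trianglelefteq)$ is a locale $X$ with a preorder $\trianglelefteq$ on $\mathcal{O}X$ such that $U_i\trianglelefteq V_i$ for all $i\in I$ implies $\bigvee_i U_i\trianglelefteq\bigvee_i V_i$. Its localic cones are $\Uparrow U:=\bigvee\{V: U\trianglelefteq V\}$ and $\Downarrow U:=\bigvee\{W: W\trianglelefteq U\}$; these are monotone with $U\sqsubseteq\Downarrow U=\Downarrow\Downarrow U$ (similarly $\Uparrow$). The localic cones preserve joins if $\Uparrow\bigvee_i U_i=\bigvee_i\Uparrow U_i$ and $\Downarrow\bigvee_i U_i=\bigvee_i\Downarrow U_i$ for all families. The ordered locale is parallel ordered if: $(\wedge^+)$ whenever $U\sqsubseteq V\trianglelefteq V'$ there is $U'$ with $U\trianglelefteq U'\sqsubseteq V'$; $(\wedge^-)$ whenever $V\trianglelefteq V'$ and $U'\sqsubseteq V'$ there is $U$ with $U\sqsubseteq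 V$ and $U\trianglelefteq U'$; $(\varnothing)$ $U\trianglelefteq\varnothing\trianglelefteq V$ implies $U=\varnothing=V$. A path is a finite sequence $p=(p_n)_{n=0}^N$ of non-empty opens (steps) with $p_n\trianglelefteq p_{n+1}$ for $0\le n<N$; its endpoint is $p_\top=p_N$. It inhabits $V$ if $p_n\sqsubseteq V$ for some $n$; it lands in $V$ if $p_\top\sqsubseteq V$. A path $q$ refines $p$, written $q\Subset p$, if for every $n$ there is $m$ with $q_m\sqsubseteq p_n$. For $W\sqsubseteq p_N$ the restriction $p|_W$ is defined by $(p|_W)_N:=W$ and $(p|_W)_n:=p_n\wedge\Downarrow(p|_W)_{n+1}$ for $0\le n<N$. A local past refinement of $p$ is a family $(q^j)_{j\in J}$ of paths with $\bigvee_j q^j_\top=p_\top$ and $q^j\Subset p|_{q^j_\top}$ for all $j$. We write $A\in\mathrm{Cov}^-_{\trianglelefteq}(U)$ ($A$ covers $U$ from below) if $A\sqsubseteq\Downarrow U$ and every path $p$ landing in $U$ has a local past refinement $(q^j)$ such that each $q^j$ inhabits $A$. A sieve on an object $C$ of a category $\mathbf{C}$ is a set $R$ of arrows with codomain $C$ such that $g\in R$ implies $g\circ h\in R$ for every arrow $h$ composable with $g$. The maximal sieve $t_C$ consists of all arrows with codomain $C$. The pullback of a sieve $R$ on $C$ along $h\colon D\to C$ is $h^*(R)=\{f\colon E\to D : h\circ f\in R\}$. Given an endofunctor $T\colon\mathbf{C}\to\mathbf{C}$ and a natural transformation $\mu\colon T^2\to T$, a $(T,\mu)$-Grothendieck topology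 on $\mathbf{C}$ is a function $J_T$ assigning to each object $C$ a collection $J_T(C)$ of sieves on $T(C)$ such that: (i) $t_{T(C)}\in J_T(C)$; (ii) if $S\in J_T(C)$ then $T(h)^*(S)\in J_T(D)$ for any arrow $h\colon D\to C$; (iii) if $S\in J_T(C)$ and $R$ is a sieve on $T(C)$ such that $(\mu_C\circ T(h))^*(R)\in J_T(D)$ for all $h\colon D\to T(C)$ in $S$, then $R\in J_T(C)$. The category $\mathcal{O}X$ has the opens as objects and a unique arrow $U\to V$ iff $U\sqsubseteq V$. A $\Downarrow$-Grothendieck topology on $\mathcal{O}X$ is a $(T,\mu)$-Grothendieck topology with $T=\Downarrow$ and $\mu_U$ the identity arrow $\Downarrow\Downarrow U=\Downarrow U$. *)

theory Defs
  imports Main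
begin

section \<open>Categories and Grothendieck topologies relative to an endofunctor\<close>

text \<open>\<open>Comp C g f\<close> is the composite "\<open>g\<close> after \<open>f\<close>"; its value is only constrained when
  \<open>Cod C f = Dom C g\<close>.\<close>

record ('o, 'm) category_data =
  Obj :: "'o set"
  Arr :: "'m set"
  Dom :: "'m \<Rightarrow> 'o"
  Cod :: "'m \<Rightarrow> 'o"
  Id :: "'o \<Rightarrow> 'm"
  Comp :: "'m \<Rightarrow> 'm \<Rightarrow> 'm"

locale category =
  fixes C :: "('o, 'm) category_data"
  assumes Dom_in: "f \<in> Arr C \<Longrightarrow> Dom C f \<in> Obj C"
    and Cod_in: "f \<in> Arr C \<Longrightarrow> Cod C f \<in> Obj C"
    and Id_arr: "A \<in> Obj C \<Longrightarrow> Id C A \<in> Arr C \<and> Dom C (Id C A) = A \<and> Cod C (Id C A) = A"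
    and Comp_arr: "\<lbrakk>f \<in> Arr C; g \<in> Arr C; Cod C f = Dom C g\<rbrakk> \<Longrightarrow>
      Comp C g f \<in> Arr C \<and> Dom C (Comp C g f) = Dom C f \<and> Cod C (Comp C g f) = Cod C g"
    and Comp_Id_right: "f \<in> Arr C \<Longrightarrow> Comp C f (Id C (Dom C f)) = f"
    and Comp_Id_left: "f \<in> Arr C \<Longrightarrow> Comp C (Id C (Cod C f)) f = f"
    and Comp_assoc: "\<lbrakk>f \<in> Arr C; g \<in> Arr C; h \<in> Arr C; Cod C f = Dom C g; Cod C g = Dom C h\<rbrakk> \<Longrightarrow>
      Comp C h (Comp C g f) = Comp C (Comp C h g) f"

locale endofunctor = category C
  for C :: "('o, 'm) category_data" +
  fixes TO :: "'o \<Rightarrow> 'o" and TA :: "'m \<Rightarrow> 'm"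
  assumes TO_in: "A \<in> Obj C \<Longrightarrow> TO A \<in> Obj C"
    and TA_arr: "f \<in> Arr C \<Longrightarrow>
      TA f \<in> Arr C \<and> Dom C (TA f) = TO (Dom C f) \<and> Cod C (TA f) = TO (Cod C f)"
    and TA_Id: "A \<in> Obj C \<Longrightarrow> TA (Id C A) = Id C (TO A)"
    and TA_Comp: "\<lbrakk>f \<in> Arr C; g \<in> Arr C; Cod C f = Dom C g\<rbrakk> \<Longrightarrow>
      TA (Comp C g f) = Comp C (TA g) (TA f)"

locale endofunctor_mult = endofunctor C TO TA
  for C :: "('o, 'm) category_data" and TO :: "'o \<Rightarrow> 'o" and TA :: "'m \<Rightarrow> 'm" +
  fixes \<mu> :: "'o \<Rightarrow> 'm"
  assumes mu_arr: "A \<in> Obj C \<Longrightarrow>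
      \<mu> A \<in> Arr C \<and> Dom C (\<mu> A) = TO (TO A) \<and> Cod C (\<mu> A) = TO A"
    and mu_natural: "f \<in> Arr C \<Longrightarrow>
      Comp C (\<mu> (Cod C f)) (TA (TA f)) = Comp C (TA f) (\<mu> (Dom C f))"

definition max_sieve :: "('o, 'm) category_data \<Rightarrow> 'o \<Rightarrow> 'm set" where
  "max_sieve C A = {f \<in> Arr C. Cod C f = A}"

definition sieve :: "('o, 'm) category_data \<Rightarrow> 'o \<Rightarrow> 'm set \<Rightarrow> bool" where
  "sieve C A R \<longleftrightarrow> R \<subseteq> {f \<in> Arr C. Cod C f = A} \<and>
     (\<forall>g\<in>R. \<forall>h\<in>Arr C. Cod C h = Dom C g \<longrightarrow> Comp C g h \<in> R)"

definition pullback_sieve :: "('o, 'm) category_data \<Rightarrow> 'm \<Rightarrow> 'm set \<Rightarrow> 'm set" where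
  "pullback_sieve C h R = {f \<in> Arr C. Cod C f = Dom C h \<and> Comp C h f \<in> R}"

locale T_Grothendieck_topology = endofunctor_mult C TO TA \<mu>
  for C :: "('o, 'm) category_data" and TO :: "'o \<Rightarrow> 'o" and TA :: "'m \<Rightarrow> 'm" and \<mu> :: "'o \<Rightarrow> 'm" +
  fixes J :: "'o \<Rightarrow> 'm set set"
  assumes J_sieve: "\<lbrakk>A \<in> Obj C; S \<in> J A\<rbrakk> \<Longrightarrow> sieve C (TO A) S"
    and J_max: "A \<in> Obj C \<Longrightarrow> max_sieve C (TO A) \<in> J A"
    and J_stable: "\<lbrakk>h \<in> Arr C; S \<in> J (Cod C h)\<rbrakk> \<Longrightarrow> pullback_sieve C (TA h) S \<in> J (Dom C h)"
    and J_transitive: "\<lbrakk>A \<in> Obj C; S \<in> J A; sieve C (TO A) R;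
        \<And>h. h \<in> S \<Longrightarrow> pullback_sieve C (Comp C (\<mu> A) (TA h)) R \<in> J (Dom C h)\<rbrakk> \<Longrightarrow> R \<in> J A"


section \<open>Ordered locales\<close>

text \<open>The frame of opens of a locale. The distributive law is weaker than that of
  \<^class>\<open>complete_distrib_lattice\<close>, which demands complete distributivity.\<close>

class frame = complete_lattice +
  assumes inf_Sup_frame: "inf a (Sup B) = Sup (inf a ` B)"

text \<open>A family of pairs \<open>U\<^sub>i \<unlhd> V\<^sub>i\<close> is represented by the set \<open>P\<close> of the pairs \<open>(U\<^sub>i, V\<^sub>i)\<close>,
  since joins depend only on the image of a family.\<close>

locale ordered_locale =
  fixes le :: "'a::frame \<Rightarrow> 'a \<Rightarrow> bool"  (infix "\<unlhd>" 50)
  assumes refl: "U \<unlhd> U"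
    and trans: "\<lbrakk>U \<unlhd> V; V \<unlhd> W\<rbrakk> \<Longrightarrow> U \<unlhd> W"
    and Sup_compat: "\<lbrakk>\<And>U V. (U, V) \<in> P \<Longrightarrow> U \<unlhd> V\<rbrakk> \<Longrightarrow> Sup (fst ` P) \<unlhd> Sup (snd ` P)"

locale parallel_ordered_locale = ordered_locale le
  for le :: "'a::frame \<Rightarrow> 'a \<Rightarrow> bool"  (infix "\<unlhd>" 50) +
  assumes wedge_plus: "\<lbrakk>U \<le> V; V \<unlhd> V'\<rbrakk> \<Longrightarrow> \<exists>U'. U \<unlhd> U' \<and> U' \<le> V'"
    and wedge_minus: "\<lbrakk>V \<unlhd> V'; U' \<le> V'\<rbrakk> \<Longrightarrow> \<exists>U. U \<le> V \<and> U \<unlhd> U'"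
    and empty: "\<lbrakk>U \<unlhd> bot; bot \<unlhd> V\<rbrakk> \<Longrightarrow> U = bot \<and> V = bot"

definition up_cone :: "('a::frame \<Rightarrow> 'a \<Rightarrow> bool) \<Rightarrow> 'a \<Rightarrow> 'a" where
  "up_cone le U = Sup {V. le U V}"

definition down_cone :: "('a::frame \<Rightarrow> 'a \<Rightarrow> bool) \<Rightarrow> 'a \<Rightarrow> 'a" where
  "down_cone le U = Sup {W. le W U}"

definition cones_preserve_joins :: "('a::frame \<Rightarrow> 'a \<Rightarrow> bool) \<Rightarrow> bool" where
  "cones_preserve_joins le \<longleftrightarrow>
     (\<forall>B. up_cone le (Sup B) = Sup (up_cone le ` B)) \<and>
     (\<forall>B. down_cone le (Sup B) = Sup (down_cone le ` B))"


section \<open>Paths and the causal coverage from below\<close>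

text \<open>A path \<open>p\<^sub>0, \<dots>, p\<^sub>N\<close> is a list of length \<open>N + 1\<close>; its endpoint is \<^term>\<open>last p\<close>.\<close>

definition is_path :: "('a::frame \<Rightarrow> 'a \<Rightarrow> bool) \<Rightarrow> 'a list \<Rightarrow> bool" where
  "is_path le p \<longleftrightarrow> p \<noteq> [] \<and> (\<forall>n<length p. p ! n \<noteq> bot) \<and>
     (\<forall>n. Suc n < length p \<longrightarrow> le (p ! n) (p ! Suc n))"

definition inhabits :: "'a::frame list \<Rightarrow> 'a \<Rightarrow> bool" where
  "inhabits p V \<longleftrightarrow> (\<exists>n<length p. p ! n \<le> V)"

definition lands_in :: "'a::frame list \<Rightarrow> 'a \<Rightarrow> bool" where
  "lands_in p V \<longleftrightarrow> last p \<le> V"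

definition refines :: "'a::frame list \<Rightarrow> 'a list \<Rightarrow> bool" where
  "refines q p \<longleftrightarrow> (\<forall>n<length p. \<exists>m<length q. q ! m \<le> p ! n)"

text \<open>\<^term>\<open>restrict_path le p W\<close> is the restriction of \<open>p\<close> to \<open>W\<close>, computed from its last step
  backwards: in the third equation the head of the recursive result is the step at index \<open>n + 1\<close>.
  The value on the empty list is irrelevant.\<close>

fun restrict_path :: "('a::frame \<Rightarrow> 'a \<Rightarrow> bool) \<Rightarrow> 'a list \<Rightarrow> 'a \<Rightarrow> 'a list" where
  "restrict_path le [] W = []"
| "restrict_path le [x] W = [W]"
| "restrict_path le (x # y # p) W =
     (let r = restrict_path le (y # p) W in inf x (down_cone le (hd r)) # r)"

text \<open>The family \<open>(q\<^sup>j)\<close> is represented by its set \<open>Q\<close> of members.\<close>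

definition local_past_refinement ::
    "('a::frame \<Rightarrow> 'a \<Rightarrow> bool) \<Rightarrow> 'a list \<Rightarrow> 'a list set \<Rightarrow> bool" where
  "local_past_refinement le p Q \<longleftrightarrow>
     (\<forall>q\<in>Q. is_path le q) \<and> Sup (last ` Q) = last p \<and>
     (\<forall>q\<in>Q. refines q (restrict_path le p (last q)))"

definition Cov_minus :: "('a::frame \<Rightarrow> 'a \<Rightarrow> bool) \<Rightarrow> 'a \<Rightarrow> 'a set" where
  "Cov_minus le U = {A. A \<le> down_cone le U \<and>
     (\<forall>p. is_path le p \<and> lands_in p U \<longrightarrow>
        (\<exists>Q. local_past_refinement le p Q \<and> (\<forall>q\<in>Q. inhabits q A)))}"


section \<open>The category of opens\<close>

text \<open>The unique arrow from \<open>U\<close> to \<open>V\<close> is the pair \<open>(U, V)\<close>.\<close>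

definition opens_category :: "('a::frame, 'a \<times> 'a) category_data" where
  "opens_category = \<lparr>Obj = UNIV, Arr = {(U, V). U \<le> V}, Dom = fst, Cod = snd,
     Id = (\<lambda>U. (U, U)), Comp = (\<lambda>g f. (fst f, snd g))\<rparr>"

definition down_cone_arr :: "('a::frame \<Rightarrow> 'a \<Rightarrow> bool) \<Rightarrow> 'a \<times> 'a \<Rightarrow> 'a \<times> 'a" where
  "down_cone_arr le f = (down_cone le (fst f), down_cone le (snd f))"

definition down_Grothendieck_topology ::
    "('a::frame \<Rightarrow> 'a \<Rightarrow> bool) \<Rightarrow> ('a \<Rightarrow> ('a \<times> 'a) set set) \<Rightarrow> bool" where
  "down_Grothendieck_topology le J \<longleftrightarrow>
     T_Grothendieck_topology opens_category (down_cone le) (down_cone_arr le)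
       (\<lambda>U. Id opens_category (down_cone le U)) J"

definition J_minus :: "('a::frame \<Rightarrow> 'a \<Rightarrow> bool) \<Rightarrow> 'a \<Rightarrow> ('a \<times> 'a) set set" where
  "J_minus le U = {R. sieve opens_category (down_cone le U) R \<and>
     Sup (Dom opens_category ` R) \<in> Cov_minus le U}"

end

theory Submission
  imports Defs
begin

text \<open>The hard axiom is transitivity. Given a path \<open>p\<close> landing in \<open>U\<close>, the covering
  \<open>A = \<Squnion>S\<close> yields paths \<open>q\<close> refining \<open>p\<close> with a step \<open>q\<^sub>n \<le> A\<close>. One wants to cut \<open>q\<^sub>n\<close> into pieces
  below the members of \<open>S\<close>, refine the part of \<open>q\<close> up to each piece by the given coverings, and
  continue along the rest of \<open>q\<close>. The difficulty is that \<open>q\<close> may visit the steps of \<open>p\<close> in a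
  different order, so that refinement of \<open>p\<close> is not inherited when the endpoint of \<open>q\<close> shrinks:
  a piece of a step of \<open>q\<close> inside \<open>p\<^sub>c\<close> must still reach the new endpoint through
  \<open>p\<^bsub>c+1\<^esub>, p\<^bsub>c+2\<^esub>, \<dots>\<close> in this order.

  The remedy is to fix the order \<open>J\<close> in which the steps of \<open>p\<close> are visited after \<open>q\<^sub>n\<close>, and to
  continue each piece by all that can be reached along \<open>J\<close>. This works if every visited
  step also sees the skipped indices followed by the remainder of \<open>J\<close>. If some step does not, let \<open>K\<close>
  be the remainder of \<open>J\<close> after the last such step. Splicing an initial segment of \<open>p\<close> in front of a
  tail of \<open>q\<close> gives a new path all of whose relevant steps see \<open>K\<close>, and the covering \<open>A\<close> is applied
  to this path instead. Only finitely many schedules \<open>K\<close> exist; those with smaller least index may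
  be forgotten when \<open>K\<close> is learned, so progress is lexicographic and the process ends.\<close>

section \<open>Cones and paths\<close>

locale cone_locale = parallel_ordered_locale le
  for le :: "'a::frame \<Rightarrow> 'a \<Rightarrow> bool"  (infix "\<unlhd>" 50) +
  assumes joins: "cones_preserve_joins le"
begin

abbreviation up :: "'a \<Rightarrow> 'a" where "up \<equiv> up_cone le"
abbreviation dn :: "'a \<Rightarrow> 'a" where "dn \<equiv> down_cone le"
abbreviation rst :: "'a list \<Rightarrow> 'a \<Rightarrow> 'a list" where "rst \<equiv> restrict_path le"
abbreviation path :: "'a list \<Rightarrow> bool" where "path \<equiv> is_path le"

section \<open>Localic cones and their interaction with the order\<close>

lemma le_sup: "a \<unlhd> b \<Longrightarrow> c \<unlhd> d \<Longrightarrow> sup a c \<unlhd> sup b d"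
  using Sup_compat[of "{(a, b), (c, d)}"] by auto

lemma le_dn: "a \<unlhd> b \<Longrightarrow> a \<le> dn b"
  unfolding down_cone_def by (rule Sup_upper) simp

lemma le_up: "a \<unlhd> b \<Longrightarrow> b \<le> up a"
  unfolding up_cone_def by (rule Sup_upper) simp

lemma dn_le: "dn b \<unlhd> b"
proof -
  have "fst ` {(W, b) |W. W \<unlhd> b} = {W. W \<unlhd> b}" "snd ` {(W, b) |W. W \<unlhd> b} = {b}"
    using refl[of b] by force+
  then show ?thesis
    using Sup_compat[of "{(W, b) |W. W \<unlhd> b}"] by (auto simp: down_cone_def)
qed

lemma le_up_self: "a \<unlhd> up a"
proof -
  have "snd ` {(a, W) |W. a \<unlhd> W} = {W. a \<unlhd> W}" "fst ` {(a, W) |W. a \<unlhd> W} = {a}"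
    using refl[of a] by force+
  then show ?thesis
    using Sup_compat[of "{(a, W) |W. a \<unlhd> W}"] by (auto simp: up_cone_def)
qed

lemma dn_mono: "a \<le> b \<Longrightarrow> dn a \<le> dn b"
  using le_dn[OF le_sup[OF dn_le[of a] refl[of b]]] by (simp add: sup.absorb2)

lemma up_mono: "a \<le> b \<Longrightarrow> up a \<le> up b"
  using le_up[OF le_sup[OF le_up_self[of a] refl[of b]]] by (simp add: sup.absorb2)

lemma dn_ext: "a \<le> dn a"
  by (rule le_dn[OF refl])

lemma dn_dn: "dn (dn a) = dn a"
  using le_dn[OF trans[OF dn_le dn_le]] dn_ext by (rule antisym)

lemma up_up: "up (up a) = up a"
  using le_up[OF trans[OF le_up_self le_up_self]] le_up[OF refl] by (rule antisym)

lemma dn_trans: "a \<le> dn b \<Longrightarrow> b \<le> dn c \<Longrightarrow> a \<le> dn c"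
  using dn_mono[of b "dn c"] by (simp add: dn_dn)

text \<open>Each parallel axiom gives one half: \<open>wedge_minus\<close> finds
  \<open>a' \<le> a\<close> with \<open>a' \<unlhd> b\<close>, and \<open>wedge_plus\<close> finds
  \<open>b' \<le> b\<close> with \<open>inf a (dn b) \<unlhd> b'\<close>. Joining the two relations
  makes both sides exact.\<close>

lemma inf_dn_le:
  assumes "b \<le> up a"
  shows "inf a (dn b) \<unlhd> b"
proof -
  obtain a' where a': "a' \<le> a" "a' \<unlhd> b"
    using wedge_minus[OF le_up_self assms] by blast
  obtain b' where b': "b' \<le> b" "inf a (dn b) \<unlhd> b'"
    using wedge_plus[OF inf.cobounded2 dn_le, of a b] by blast
  have "a' \<le> inf a (dn b)" using a' le_dn by simp
  then show ?thesis
    using le_sup[OF b'(2) a'(2)] b'(1) by (metis sup.absorb1 sup.absorb2)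
qed

lemma le_inf_up:
  assumes "a \<le> dn b"
  shows "a \<unlhd> inf b (up a)"
proof -
  obtain b' where b': "b' \<le> b" "a \<unlhd> b'"
    using wedge_plus[OF assms dn_le] by blast
  obtain a' where a': "a' \<le> a" "a' \<unlhd> inf b (up a)"
    using wedge_minus[OF le_up_self inf.cobounded2, of a b] by blast
  have "b' \<le> inf b (up a)" using b' le_up by simp
  then show ?thesis
    using le_sup[OF b'(2) a'(2)] a'(1) by (metis sup.absorb1 sup.absorb2)
qed

lemma dn_inf_up: "a \<le> dn b \<Longrightarrow> a \<le> dn (inf b (up a))"
  using le_dn[OF le_inf_up] .

lemma bot_left: "bot \<unlhd> b \<Longrightarrow> b = bot"
  using empty[OF refl] by blast

lemma bot_right: "a \<unlhd> bot \<Longrightarrow> a = bot"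
  using empty[OF _ refl] by blast

lemma up_Sup: "up (Sup B) = Sup (up ` B)"
  using joins by (simp add: cones_preserve_joins_def)

section \<open>Paths and their restrictions\<close>

lemma path_le:
  assumes "path p" "i \<le> j" "j < length p"
  shows "p ! i \<unlhd> p ! j"
  using assms(2,3)
proof (induction j rule: dec_induct)
  case base
  show ?case by (rule refl)
next
  case (step j)
  then have "p ! j \<unlhd> p ! Suc j" using assms(1) by (simp add: is_path_def)
  moreover have "p ! i \<unlhd> p ! j" using step by simp
  ultimately show ?case by (rule trans[rotated])
qed

lemma path_Cons:
  "path (x # xs) \<longleftrightarrow> x \<noteq> bot \<and> (xs = [] \<or> x \<unlhd> hd xs \<and> path xs)"
proof (cases xs)
  case Nil
  then show ?thesis by (simp add: is_path_def)
next
  case (Cons y ys)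
  have "(\<forall>n. Suc n < length (x # y # ys) \<longrightarrow> P n) \<longleftrightarrow>
      P 0 \<and> (\<forall>n. Suc n < length (y # ys) \<longrightarrow> P (Suc n))" for P
    using All_less_Suc2[of "length ys" P] by simp
  moreover have "(\<forall>n<length (x # y # ys). P n) \<longleftrightarrow> P 0 \<and> (\<forall>n<length (y # ys). P (Suc n))" for P
    using All_less_Suc2[of "length (y # ys)" P] by simp
  ultimately show ?thesis
    unfolding Cons is_path_def by (simp del: length_Cons) blast
qed

lemma path_append:
  "path xs \<Longrightarrow> path ys \<Longrightarrow> last xs \<unlhd> hd ys \<Longrightarrow> path (xs @ ys)"
proof (induction xs)
  case Nil
  then show ?case by simp
next
  case (Cons x xs)
  then show ?case by (cases xs) (auto simp: path_Cons)
qed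

lemma path_drop: "path q \<Longrightarrow> n < length q \<Longrightarrow> path (drop n q)"
  by (auto simp: is_path_def)

lemma path_take: "path q \<Longrightarrow> path (take (Suc n) q)"
  by (auto simp: is_path_def)

lemma length_rst [simp]: "length (rst p W) = length p"
  by (induction le p W rule: restrict_path.induct) (auto simp: Let_def)

lemma rst_Nil_iff [simp]: "rst p W = [] \<longleftrightarrow> p = []"
  unfolding length_0_conv[symmetric] length_rst ..

lemma rst_last: "p \<noteq> [] \<Longrightarrow> rst p W ! (length p - Suc 0) = W"
  by (induction le p W rule: restrict_path.induct) (auto simp: Let_def)

lemma rst_Cons: "p \<noteq> [] \<Longrightarrow> rst (x # p) W = inf x (dn (hd (rst p W))) # rst p W"
  by (cases p) (simp_all add: Let_def)

lemma rst_nth: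
  "Suc c < length p \<Longrightarrow> rst p W ! c = inf (p ! c) (dn (rst p W ! Suc c))"
proof (induction p arbitrary: c)
  case (Cons x p)
  then have "p \<noteq> []" by auto
  then show ?case
    using Cons.prems Cons.IH[of "c - 1"] by (cases c) (simp_all add: rst_Cons hd_conv_nth)
qed simp

lemma last_rst: "p \<noteq> [] \<Longrightarrow> last (rst p W) = W"
  using rst_last[of p W] by (simp add: last_conv_nth)

lemma rst_le:
  assumes "c < length p" "W \<le> last p"
  shows "rst p W ! c \<le> p ! c"
proof (cases "Suc c < length p")
  case True
  then show ?thesis by (simp add: rst_nth)
next
  case False
  then have "c = length p - Suc 0" "p \<noteq> []" using assms by auto
  then show ?thesis using assms by (simp add: rst_last last_conv_nth)
qed

lemma rst_dn:
  assumes "c \<le> d" "d < length p"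
  shows "rst p W ! c \<le> dn (rst p W ! d)"
  using assms
proof (induction d rule: dec_induct)
  case base
  show ?case by (rule dn_ext)
next
  case (step d)
  then have "rst p W ! d \<le> dn (rst p W ! Suc d)" by (simp add: rst_nth)
  moreover have "rst p W ! c \<le> dn (rst p W ! d)" using step by simp
  ultimately show ?case by (rule dn_trans[rotated])
qed

text \<open>Consecutive steps are related by \<open>inf_dn_le\<close>. Non-emptiness travels
  backwards from \<open>W\<close> by \<open>bot_left\<close>.\<close>

lemma path_rst:
  assumes "path p" "W \<le> last p" "W \<noteq> bot"
  shows "path (rst p W)"
proof -
  have ne: "p \<noteq> []" using assms by (simp add: is_path_def)
  have step_le: "rst p W ! c \<unlhd> rst p W ! Suc c" if "Suc c < length p" for c
  proof -
    have "p ! Suc c \<le> up (p ! c)"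
      using assms(1) that by (intro le_up) (simp add: is_path_def)
    then have "rst p W ! Suc c \<le> up (p ! c)"
      using rst_le[OF that assms(2)] by simp
    then show ?thesis using inf_dn_le rst_nth[OF that] by metis
  qed
  have "rst p W ! c \<noteq> bot" if "c < length p" for c
  proof -
    have "c \<le> length p - Suc 0" using that by simp
    then show ?thesis
    proof (induction rule: inc_induct)
      case base
      show ?case using ne assms by (simp add: rst_last)
    next
      case (step c)
      have "rst p W ! c \<unlhd> rst p W ! Suc c" using step.hyps by (intro step_le) simp
      then show ?case using bot_left step.IH by metis
    qed
  qed
  then show ?thesis
    using step_le ne by (simp add: is_path_def)
qed

lemma rst_last_id:
  assumes "path p"
  shows "c < length p \<Longrightarrow> p ! c \<le> rst p (last p) ! c"
proof -
  have ne: "p \<noteq> []" using assms by (simp add: is_path_def)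
  assume "c < length p"
  then have "c \<le> length p - 1" by simp
  then show ?thesis
  proof (induction rule: inc_induct)
    case base
    show ?case using ne by (simp add: rst_last last_conv_nth)
  next
    case (step c)
    then have "p ! c \<unlhd> p ! Suc c" using assms by (simp add: is_path_def)
    then have "p ! c \<le> dn (p ! Suc c)" by (rule le_dn)
    also have "\<dots> \<le> dn (rst p (last p) ! Suc c)" using step.IH by (rule dn_mono)
    finally show ?case using step.hyps by (simp add: rst_nth)
  qed
qed

lemma path_le_last: "path p \<Longrightarrow> i < length p \<Longrightarrow> p ! i \<unlhd> last p"
  using path_le[of p i "length p - 1"] by (simp add: is_path_def last_conv_nth)

lemma refines_iff: "refines q r \<longleftrightarrow> (\<forall>c<length r. \<exists>x\<in>set q. x \<le> r ! c)"
  unfolding refines_def by (metis in_set_conv_nth)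

lemma inhabits_iff: "inhabits q V \<longleftrightarrow> (\<exists>x\<in>set q. x \<le> V)"
  unfolding inhabits_def by (metis in_set_conv_nth)

section \<open>Following a schedule\<close>

text \<open>A schedule is a list of indices of steps of \<open>p\<close>. An open below \<open>run_to p c h X\<close> can
  travel through \<open>p\<^bsub>c+1\<^esub>, \<dots>, p\<^bsub>h-1\<^esub>\<close> and then reach \<open>X\<close>; for \<open>h \<le> c + 1\<close> it just reaches \<open>X\<close>.\<close>

function run_to :: "'a list \<Rightarrow> nat \<Rightarrow> nat \<Rightarrow> 'a \<Rightarrow> 'a" where
  "run_to p c h X = (if Suc c < h then dn (inf (p ! Suc c) (run_to p (Suc c) h X)) else dn X)"
  by pat_completeness auto
termination by (relation "measure (\<lambda>(p, c, h, X). h - c)") auto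

declare run_to.simps [simp del]

text \<open>The index of the endpoint is included because every schedule tacitly ends there; it is
  the value for the empty schedule.\<close>

definition low :: "'a list \<Rightarrow> nat list \<Rightarrow> nat" where
  "low p K = Min (insert (length p - Suc 0) (set K))"

text \<open>From \<open>ready p K\<close> there is a single chain that follows \<open>K\<close> through ready steps and also
  contains all indices from \<open>hd K\<close> upwards in increasing order. Only the indices below the least one
  in the rest of the schedule have to be inserted, as the rest takes over from there.\<close>

fun ready :: "'a list \<Rightarrow> nat list \<Rightarrow> 'a" where
  "ready p [] = last p"
| "ready p (c # K) = inf (p ! c) (run_to p c (low p K) (ready p K))"

fun reach :: "'a list \<Rightarrow> 'a \<Rightarrow> nat list \<Rightarrow> 'a" where
  "reach p X [] = inf (last p) (up X)"
| "reach p X (c # K) = reach p (inf (ready p (c # K)) (up X)) K"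

text \<open>The steps collected by \<^const>\<open>reach\<close> need not form a path, because parts of
  them may fail to continue; \<open>follow\<close> prunes those parts, and keeps the endpoint.\<close>

fun follow :: "'a list \<Rightarrow> 'a \<Rightarrow> nat list \<Rightarrow> 'a list" where
  "follow p X [] = [inf (last p) (up X)]"
| "follow p X (c # K) =
     (let r = follow p (inf (ready p (c # K)) (up X)) K
      in inf (inf (ready p (c # K)) (up X)) (dn (hd r)) # r)"

lemma run_to_le: "run_to p c h X \<le> dn X"
proof (induction p c h X rule: run_to.induct)
  case (1 p c h X)
  show ?case
  proof (cases "Suc c < h")
    case True
    have "inf (p ! Suc c) (run_to p (Suc c) h X) \<le> dn X"
      using 1[OF True] by (simp add: le_infI2)
    then show ?thesis
      using dn_mono dn_dn True by (metis run_to.simps)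
  next
    case False
    then show ?thesis by (simp add: run_to.simps)
  qed
qed

lemma reach_mono: "X \<le> Y \<Longrightarrow> reach p X K \<le> reach p Y K"
proof (induction K arbitrary: X Y)
  case Nil
  then show ?case using up_mono by (simp add: le_infI2)
next
  case (Cons c K)
  have "inf (ready p (c # K)) (up X) \<le> inf (ready p (c # K)) (up Y)"
    by (rule inf_mono[OF order_refl up_mono[OF Cons.prems]])
  then show ?case using Cons.IH by simp
qed

lemma reach_inf_up: "reach p (inf a (up X)) K \<le> reach p X K"
proof -
  have "inf b (up (inf a (up X))) \<le> inf b (up X)" for b
    using up_mono[of "inf a (up X)" "up X"] by (simp add: up_up le_infI2)
  then show ?thesis by (cases K) (auto simp del: ready.simps intro: reach_mono)
qed

lemma inf_up_Sup: "inf a (up (Sup B)) = Sup ((\<lambda>X. inf a (up X)) ` B)"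
  by (simp add: up_Sup inf_Sup_frame image_image)

text \<open>Upper cones preserve joins, and meets distribute over them. This is what lets a step be
  cut into pieces without losing any of the endpoint.\<close>

lemma reach_Sup: "reach p (Sup B) K = Sup ((\<lambda>X. reach p X K) ` B)"
proof (induction K arbitrary: B)
  case Nil
  then show ?case by (simp add: inf_up_Sup)
next
  case (Cons c K)
  show ?case
    unfolding reach.simps inf_up_Sup Cons.IH by (simp add: image_image)
qed

lemma reach_le_last: "reach p X K \<le> last p"
  by (induction K arbitrary: X) simp_all

lemma follow_not_Nil [simp]: "follow p X K \<noteq> []"
  by (cases K) (simp_all add: Let_def)

lemma last_follow: "last (follow p X K) = reach p X K"
  by (induction K arbitrary: X) (simp_all add: Let_def)

lemma hd_follow_le: "hd (follow p X K) \<le> inf (ready p K) (up X)"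
  by (cases K) (simp_all add: Let_def le_infI1)

lemma hd_follow_mono: "X \<le> Y \<Longrightarrow> hd (follow p X K) \<le> hd (follow p Y K)"
proof (induction K arbitrary: X Y)
  case Nil
  then show ?case using up_mono by (simp add: le_infI2)
next
  case (Cons c K)
  have *: "inf (ready p (c # K)) (up X) \<le> inf (ready p (c # K)) (up Y)"
    by (rule inf_mono[OF order_refl up_mono[OF Cons.prems]])
  show ?case using inf_mono[OF * dn_mono[OF Cons.IH[OF *]]] by (simp add: Let_def)
qed

text \<open>Pruning relates consecutive steps by \<open>inf_dn_le\<close>. Only \<open>bot\<close>
  is related to \<open>bot\<close>, so a non-empty head forces all later steps to be
  non-empty.\<close>

lemma path_follow: "hd (follow p X K) \<noteq> bot \<Longrightarrow> path (follow p X K)"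
proof (induction K arbitrary: X)
  case Nil
  then show ?case by (simp add: path_Cons)
next
  case (Cons c K)
  define Y where "Y = inf (ready p (c # K)) (up X)"
  have eq: "follow p X (c # K) = inf Y (dn (hd (follow p Y K))) # follow p Y K"
    by (simp add: Let_def Y_def)
  have le: "inf Y (dn (hd (follow p Y K))) \<unlhd> hd (follow p Y K)"
    using hd_follow_le by (intro inf_dn_le) (simp add: le_infE)
  have "hd (follow p Y K) \<noteq> bot"
    using le bot_right Cons.prems unfolding eq by force
  then show ?case
    using Cons.IH le Cons.prems unfolding eq by (simp add: path_Cons)
qed

lemma le_hd_follow: "X \<le> dn (hd (follow p X K)) \<Longrightarrow> X \<unlhd> hd (follow p X K)"
  using le_inf_up[of X "hd (follow p X K)"] hd_follow_le[of p X K]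
  by (simp add: inf.absorb1)

context
  fixes p :: "'a list" and N :: nat
  assumes path_p: "path p"
  defines "N \<equiv> length p - Suc 0"
begin

lemma length_p: "length p = Suc N"
  using path_p by (auto simp: is_path_def N_def)

lemma last_p: "last p = p ! N"
  using path_p by (simp add: is_path_def N_def last_conv_nth)

lemma low_in: "low p K \<in> insert N (set K)"
  unfolding low_def N_def by (rule Min_in) auto

lemma low_le: "c \<in> insert N (set K) \<Longrightarrow> low p K \<le> c"
  unfolding low_def N_def by (rule Min_le) auto

lemma rst_N: "rst p W ! N = W"
  using path_p rst_last unfolding is_path_def N_def by blast

text \<open>This is why readiness yields refinement: to lie in the restriction at \<open>c\<close>,
  an open inside \<open>p ! c\<close> must reach the restriction at \<open>Suc c\<close>. The run
  inside \<open>ready\<close> provides this up to the least index of the rest, and the rest of the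
  schedule does so from there. Appending \<open>N\<close> covers the empty schedule.\<close>

lemma ready_visits:
  assumes "set K \<subseteq> {..<N}" "reach p X K \<le> W"
  shows "inf (ready p K) (up X) \<le> rst p W ! hd (K @ [N])
    \<and> (\<forall>c\<in>insert N (set K). inf (ready p K) (up X) \<le> dn (rst p W ! c))"
  using assms
proof (induction K arbitrary: X)
  case Nil
  then show ?case using dn_ext[of W] by (simp add: rst_N)
next
  case (Cons j K)
  define h where "h = low p K"
  have h: "h \<in> insert N (set K)" "h \<le> N"
    using low_in low_le unfolding h_def by blast+
  have visit: "Z \<le> rst p W ! c"
    if "c < N" "Z \<le> p ! c" "Z \<le> run_to p c h (ready p K)" "reach p Z K \<le> W" for c Z
    using that
  proof (induction "h - c" arbitrary: c Z rule: less_induct)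
    case less
    have "Z \<le> dn (rst p W ! Suc c)"
    proof (cases "Suc c < h")
      case True
      define Z' where "Z' = inf (inf (p ! Suc c) (run_to p (Suc c) h (ready p K))) (up Z)"
      have "Z \<le> dn Z'"
        using less.prems(3) True unfolding Z'_def
        by (intro dn_inf_up) (simp add: run_to.simps[of p c])
      moreover have "Z' \<le> rst p W ! Suc c"
      proof (rule less.hyps)
        have "reach p Z' K \<le> reach p Z K"
          unfolding Z'_def by (rule reach_inf_up)
        then show "reach p Z' K \<le> W" using less.prems(4) by simp
      qed (use True h in \<open>auto simp: Z'_def intro: le_infI1\<close>)
      ultimately show ?thesis
        using dn_mono order_trans by blast
    next
      case False
      \<comment> \<open>Now \<open>h \<le> Suc c\<close>, so it suffices to reach the restriction at
        \<open>h\<close>, which in turn reaches the one at \<open>Suc c\<close>.\<close>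
      have "Z \<le> dn (ready p K)"
        using run_to_le less.prems(3) order_trans by blast
      then have "Z \<le> dn (inf (ready p K) (up Z))" by (rule dn_inf_up)
      moreover have "inf (ready p K) (up Z) \<le> dn (rst p W ! h)"
        using Cons.IH[of Z] Cons.prems(1) less.prems(4) h by auto
      moreover have "rst p W ! h \<le> dn (rst p W ! Suc c)"
        using less.prems(1) False length_p by (intro rst_dn) auto
      ultimately show ?thesis using dn_trans by blast
    qed
    then show ?case using less.prems length_p by (simp add: rst_nth)
  qed
  define Y where "Y = inf (ready p (j # K)) (up X)"
  have Y: "reach p Y K \<le> W" "Y \<le> p ! j" "Y \<le> run_to p j h (ready p K)" "j < N"
    using Cons.prems by (auto simp: Y_def h_def intro: le_infI1)
  have 1: "Y \<le> rst p W ! j" using visit Y by blast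
  have "Y \<le> dn (inf (ready p K) (up Y))"
    using Y(3) run_to_le order_trans by (intro dn_inf_up) blast
  moreover have "\<forall>c\<in>insert N (set K). inf (ready p K) (up Y) \<le> dn (rst p W ! c)"
    using Cons.IH[OF _ Y(1)] Cons.prems(1) by simp
  ultimately have "\<forall>c\<in>insert N (set K). Y \<le> dn (rst p W ! c)"
    using dn_trans by blast
  then show ?case
    using 1 dn_ext[of "rst p W ! j"] unfolding Y_def[symmetric] by auto
qed

lemma follow_visits:
  assumes "set K \<subseteq> {..<N}" "reach p X K \<le> W" "c \<in> set K"
  shows "\<exists>x\<in>set (follow p X K). x \<le> rst p W ! c"
  using assms
proof (induction K arbitrary: X)
  case (Cons j K)
  define Y where "Y = inf (ready p (j # K)) (up X)"
  have eq: "follow p X (j # K) = inf Y (dn (hd (follow p Y K))) # follow p Y K"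
    by (simp add: Let_def Y_def)
  show ?case
  proof (cases "c = j")
    case True
    then have "Y \<le> rst p W ! c"
      using ready_visits[OF Cons.prems(1,2)] by (simp add: Y_def)
    then show ?thesis unfolding eq by (auto intro: le_infI1)
  next
    case False
    then show ?thesis using Cons unfolding eq by (auto simp: Y_def)
  qed
qed simp

text \<open>Here \<open>m\<close> chooses, for each index of \<open>p\<close>, a position in
  \<open>q\<close> at which that step is visited.\<close>

fun all_ready :: "'a list \<Rightarrow> (nat \<Rightarrow> nat) \<Rightarrow> nat list \<Rightarrow> bool" where
  "all_ready q m [] \<longleftrightarrow> True"
| "all_ready q m (c # K) \<longleftrightarrow> q ! m c \<le> ready p (c # K) \<and> all_ready q m K"

lemma not_all_ready:
  "\<not> all_ready q m J \<Longrightarrow>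
    \<exists>J' g K. J = J' @ g # K \<and> all_ready q m K \<and> \<not> q ! m g \<le> ready p (g # K)"
proof (induction J)
  case (Cons c J)
  show ?case
  proof (cases "all_ready q m J")
    case True
    then show ?thesis using Cons.prems by (intro exI[of _ "[]"]) auto
  next
    case False
    then show ?thesis using Cons.IH by (metis append_Cons)
  qed
qed simp

text \<open>Nothing of \<open>X\<close> is lost to pruning: the parts of the later visits in
  \<open>q\<close> that lie in the successive upper cones form a chain along
  \<open>K\<close>.\<close>

lemma follow_from:
  assumes "path q" "last q \<le> last p" "all_ready q m K" "sorted (map m K)"
    and "\<forall>c\<in>set K. i \<le> m c \<and> m c < length q" "i < length q" "X \<le> q ! i"
  shows "X \<le> dn (hd (follow p X K))"
  using assms(3-)
proof (induction K arbitrary: i X)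
  case Nil
  have "X \<le> dn (last q)"
    using Nil le_dn[OF path_le_last[OF assms(1)]] order_trans by blast
  then have "X \<le> dn (last p)" using dn_mono[OF assms(2)] order_trans by blast
  then show ?case by (simp add: dn_inf_up)
next
  case (Cons j K)
  define Y where "Y = inf (ready p (j # K)) (up X)"
  define X' where "X' = inf (q ! m j) (up X)"
  have eq: "follow p X (j # K) = inf Y (dn (hd (follow p Y K))) # follow p Y K"
    by (simp add: Let_def Y_def)
  have "q ! i \<le> dn (q ! m j)"
    using Cons.prems by (intro le_dn path_le[OF assms(1)]) auto
  then have "X \<le> dn X'"
    using Cons.prems(5) unfolding X'_def by (intro dn_inf_up) simp
  moreover have "X' \<le> Y"
    using Cons.prems(1) unfolding X'_def Y_def by (simp add: le_infI1 del: ready.simps)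
  moreover have "X' \<le> dn (hd (follow p X' K))"
    by (rule Cons.IH[of "m j"]) (use Cons.prems in \<open>auto simp: X'_def\<close>)
  moreover have "dn (hd (follow p X' K)) \<le> dn (hd (follow p Y K))"
    using \<open>X' \<le> Y\<close> by (intro dn_mono hd_follow_mono)
  ultimately have "X \<le> dn X'" "X' \<le> inf Y (dn (hd (follow p Y K)))"
    by (blast intro: inf_greatest order_trans)+
  then have "X \<le> dn (inf Y (dn (hd (follow p Y K))))" by (rule order_trans[OF _ dn_mono])
  then show ?case unfolding eq by simp
qed

lemma reach_from:
  assumes "path q" "last q \<le> last p" "all_ready q m K" "sorted (map m K)"
    and "\<forall>c\<in>set K. i \<le> m c \<and> m c < length q" "i < length q" "q ! i \<le> X"
  shows "last q \<le> reach p X K"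
  using assms(3-)
proof (induction K arbitrary: i X)
  case Nil
  have "last q \<le> up (q ! i)"
    using Nil by (intro le_up path_le_last[OF assms(1)])
  then show ?case using assms(2) up_mono[OF Nil(5)] by simp
next
  case (Cons j K)
  have "q ! m j \<le> up (q ! i)"
    using Cons.prems by (intro le_up path_le[OF assms(1)]) auto
  then have "q ! m j \<le> inf (ready p (j # K)) (up X)"
    using Cons.prems(1) up_mono[OF Cons.prems(5)] by simp
  then show ?case
    using Cons.prems Cons.IH[of "m j"] by simp
qed

lemma run_path:
  assumes "c < N"
  shows "p ! c \<le> run_to p c N (last p)"
  using assms
proof (induction "N - c" arbitrary: c rule: less_induct)
  case less
  have "p ! c \<unlhd> p ! Suc c"
    using path_p less.prems length_p by (simp add: is_path_def)
  then have le: "p ! c \<le> dn (p ! Suc c)" by (rule le_dn)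
  show ?case
  proof (cases "Suc c < N")
    case True
    then have "p ! Suc c \<le> run_to p (Suc c) N (last p)" using less by simp
    then show ?thesis
      using le True by (simp add: run_to.simps[of p c] inf.absorb1)
  next
    case False
    then have "Suc c = N" using less.prems by simp
    then show ?thesis using le by (simp add: run_to.simps[of p c] last_p)
  qed
qed

section \<open>Learning schedules\<close>

text \<open>After any shrinking of \<open>a\<close>, the path through \<open>R\<close> and \<open>a\<close> can be continued
  along \<open>J\<close>; the indices below \<open>length R\<close> have been visited in increasing order before \<open>a\<close>.\<close>

definition robust :: "'a \<Rightarrow> 'a list \<Rightarrow> 'a \<Rightarrow> nat list \<Rightarrow> bool" where
  "robust A R a J \<longleftrightarrow> path (R @ [a]) \<and> length R \<le> N \<and> (\<forall>c<length R. R ! c \<le> p ! c) \<and>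
     set J = {length R..<N} \<and> a \<le> A \<and> (\<forall>X\<le>a. X \<le> dn (hd (follow p X J)))"

text \<open>When \<open>c < low p K\<close>, the bounds give \<open>x \<le> ready p (c # K)\<close>,
  so a step that fails before a remainder \<open>K\<close> reveals an unlearned schedule. The clause
  for \<open>hd K = c\<close> keeps a ready visit available for restarts.\<close>

definition known :: "nat list set \<Rightarrow> nat \<Rightarrow> 'a \<Rightarrow> bool" where
  "known T c x \<longleftrightarrow> x \<le> p ! c \<and>
     (\<forall>K\<in>T. (hd K = c \<longrightarrow> x \<le> ready p K) \<and> (c < low p K \<longrightarrow> x \<le> run_to p c (low p K) (ready p K)))"

lemma known_mono: "known T c x \<Longrightarrow> y \<le> x \<Longrightarrow> known T c y"
  unfolding known_def by (meson order_trans)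

definition schedules :: "nat list set" where
  "schedules = {K. K \<noteq> [] \<and> distinct K \<and> set K \<subseteq> {..<N}}"

lemma finite_schedules: "finite schedules"
  using finite_subset_distinct[of "{..<N}"]
  by (rule rev_finite_subset) (auto simp: schedules_def)

definition weight :: "nat list set \<Rightarrow> nat" where
  "weight T = (\<Sum>K\<in>T. Suc (card schedules) ^ low p K)"

text \<open>The weight is a numeral in base \<open>card schedules + 1\<close>, so that it orders sets of schedules
  lexicographically, larger least indices first.\<close>

lemma weight_less:
  assumes T: "T \<subseteq> schedules" and K: "K \<in> schedules" "K \<notin> T"
  shows "weight T < weight (insert K {K' \<in> T. low p K \<le> low p K'})"
proof -
  define B where "B = Suc (card schedules)"
  define T1 where "T1 = {K' \<in> T. low p K \<le> low p K'}"
  define T2 where "T2 = {K' \<in> T. low p K' < low p K}"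
  have fin: "finite T1" "finite T2"
    using finite_subset[OF T finite_schedules] by (simp_all add: T1_def T2_def)
  have "T1 \<inter> T2 = {}" "T1 \<union> T2 = T" by (auto simp: T1_def T2_def)
  then have "weight T = weight T1 + weight T2"
    unfolding weight_def using sum.union_disjoint[OF fin] by metis
  moreover have "K \<notin> T1" using K(2) by (simp add: T1_def)
  then have "weight (insert K T1) = B ^ low p K + weight T1"
    unfolding weight_def using fin by (simp add: B_def)
  \<comment> \<open>At most \<open>B - 1\<close> schedules are forgotten, all with exponents below
    \<open>low p K\<close>, so together they weigh less than the one learned.\<close>
  moreover have "weight T2 < B ^ low p K"
  proof (cases "low p K")
    case 0
    then show ?thesis by (simp add: weight_def T2_def)
  next
    case (Suc l)
    have "B ^ low p K' \<le> B ^ l" if "K' \<in> T2" for K'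
      using that Suc by (intro power_increasing) (auto simp: T2_def B_def)
    then have "weight T2 \<le> card T2 * B ^ l"
      unfolding weight_def B_def using sum_bounded_above[of T2] by (metis of_nat_id)
    also have "card T2 \<le> card schedules"
      using T finite_schedules by (intro card_mono) (auto simp: T2_def)
    then have "card T2 * B ^ l \<le> card schedules * B ^ l" by (rule mult_le_mono1)
    also have "\<dots> < B * B ^ l" by (simp add: B_def)
    finally show ?thesis using Suc by simp
  qed
  ultimately show ?thesis by (simp add: T1_def)
qed

lemma weight_le: "T \<subseteq> schedules \<Longrightarrow> weight T \<le> weight schedules"
  unfolding weight_def using finite_schedules by (intro sum_mono2) auto

lemma low_schedule:
  assumes "K \<in> schedules"
  shows "low p K < N" "low p K \<le> hd K" "hd K < N" "hd K \<in> set K"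
proof -
  show hd: "hd K \<in> set K" using assms by (simp add: schedules_def)
  then show "hd K < N" using assms by (auto simp: schedules_def subset_iff)
  moreover show "low p K \<le> hd K" using hd by (intro low_le) simp
  ultimately show "low p K < N" by simp
qed

text \<open>Starting at the first visit \<open>m s\<close> of an index \<open>\<ge> low p K\<close> retains all visits of
  such indices. The smaller indices are visited afresh, and learn what \<open>q\<^bsub>m s\<^esub>\<close> knows by running up to it.\<close>

lemma known_restart:
  assumes T: "T \<subseteq> schedules" and q: "path q"
    and m: "\<forall>c<N. m c < length q \<and> known T c (q ! m c)"
    and K: "K \<in> schedules" "q ! m (hd K) \<le> ready p K"
    and s: "low p K \<le> s" "s < N" "\<forall>c. low p K \<le> c \<and> c < N \<longrightarrow> m s \<le> m c"
  defines "u \<equiv> rst (take (Suc s) p) (q ! m s) @ drop (m s) q"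
  shows "path u \<and> last u = last q \<and>
    (\<forall>c<N. \<exists>x\<in>set u. known (insert K {K' \<in> T. low p K \<le> low p K'}) c x)"
proof -
  define T' where "T' = insert K {K' \<in> T. low p K \<le> low p K'}"
  define y where "y = q ! m s"
  define P where "P = take (Suc s) p"
  have len: "length P = Suc s" and P: "\<And>c. c \<le> s \<Longrightarrow> P ! c = p ! c"
    using s length_p by (auto simp: P_def)
  have P_ne: "P \<noteq> []" using len by auto
  have last_P: "last P = p ! s" using len P P_ne by (simp add: last_conv_nth)
  have ms: "m s < length q" "known T s y" using m s by (auto simp: y_def)
  have y: "y \<le> last P" "y \<noteq> bot"
    using ms q by (auto simp: last_P known_def y_def is_path_def)
  have "path u"
  proof -
    have "path (rst P y)"
      using path_take[OF path_p] y unfolding P_def by (rule path_rst)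
    moreover have "path (drop (m s) q)" using path_drop[OF q ms(1)] .
    moreover have "last (rst P y) = hd (drop (m s) q)"
      using ms(1) P_ne by (simp add: last_rst hd_drop_conv_nth y_def)
    ultimately show ?thesis
      unfolding u_def P_def[symmetric] y_def[symmetric] using refl by (intro path_append) auto
  qed
  moreover have "last u = last q" using ms(1) by (simp add: u_def)
  moreover have "\<exists>x\<in>set u. known T' c x" if c: "c < N" for c
  proof (cases "low p K \<le> c")
    case True
    have "m s \<le> m c" "m c < length q" using s(3) True c m by auto
    then have "q ! m c \<in> set (drop (m s) q)"
      using nth_mem[of "m c - m s" "drop (m s) q"] by simp
    moreover have "known T' c (q ! m c)"
      using m c K(2) True low_schedule(4)[OF K(1)] by (auto simp: known_def T'_def)
    ultimately show ?thesis unfolding u_def by auto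
  next
    case False
    \<comment> \<open>Each such schedule starts at an index from \<open>low p K\<close> on, which
      \<open>q\<close> visits no earlier than position \<open>m s\<close>.\<close>
    have y_ready: "y \<le> dn (ready p K')" if "K' \<in> T'" for K'
    proof -
      have K': "K' \<in> schedules" "low p K \<le> low p K'" "q ! m (hd K') \<le> ready p K'"
        using that K T m low_schedule by (auto simp: T'_def known_def)
      then have "m s \<le> m (hd K')" "m (hd K') < length q"
        using low_schedule[OF K'(1)] s m by auto
      then have "y \<le> dn (q ! m (hd K'))"
        unfolding y_def by (intro le_dn path_le[OF q])
      then show ?thesis using dn_mono[OF K'(3)] order_trans by blast
    qed
    have run: "rst P y ! d \<le> run_to p d (low p K') (ready p K')" if "K' \<in> T'" "d \<le> s" for d K'
      using that(2)
    proof (induction rule: inc_induct)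
      case base
      have "rst P y ! s = y" using rst_last[OF P_ne, of y] len by simp
      moreover have "y \<le> run_to p s (low p K') (ready p K')"
      proof (cases "s < low p K'")
        case True
        then have "K' \<in> T" using that(1) s(1) by (auto simp: T'_def)
        then show ?thesis using True ms(2) by (simp add: known_def)
      next
        case False
        then show ?thesis using y_ready[OF that(1)] by (simp add: run_to.simps[of p s])
      qed
      ultimately show ?case by simp
    next
      case (step d)
      define x where "x = rst P y ! Suc d"
      have le: "rst P y ! d \<le> dn x" using step len by (simp add: rst_nth x_def)
      have x: "x \<le> p ! Suc d" "x \<le> run_to p (Suc d) (low p K') (ready p K')"
        using rst_le[of "Suc d" P y] y(1) P[of "Suc d"] step len by (auto simp: x_def)
      show ?case
      proof (cases "Suc d < low p K'")
        case True
        then show ?thesis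
          using x order_trans[OF le dn_mono[of x]] by (simp add: run_to.simps[of p d])
      next
        case False
        have "x \<le> dn (ready p K')" using x(2) run_to_le order_trans by blast
        then show ?thesis
          using False dn_trans[OF le] by (simp add: run_to.simps[of p d])
      qed
    qed
    have c_le: "c \<le> s" using False s by simp
    have "known T' c (rst P y ! c)"
      unfolding known_def
    proof (intro conjI ballI impI)
      show "rst P y ! c \<le> p ! c"
        using rst_le[of c P y] y(1) P c_le len by simp
    next
      fix K' assume K': "K' \<in> T'"
      show "rst P y ! c \<le> run_to p c (low p K') (ready p K')" using run K' c_le .
      assume "hd K' = c"
      moreover have "low p K \<le> hd K'"
        using K' K(1) T low_schedule(2) by (force simp: T'_def)
      ultimately show "rst P y ! c \<le> ready p K'" using False by simp
    qed
    moreover have "rst P y ! c \<in> set (rst P y)" using c_le len by simp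
    ultimately show ?thesis unfolding u_def P_def[symmetric] y_def[symmetric] by auto
  qed
  ultimately show ?thesis unfolding T'_def by blast
qed

text \<open>Induction on the weight still to be gained. A member \<open>q\<close> of the refinement
  of \<open>u\<close> is either ready along its own order of visits, and then \<open>last q\<close>
  lies in some \<open>reach\<close>, or it teaches a new schedule to a spliced path with the same
  endpoint.\<close>

lemma robust_cover:
  assumes A: "A \<in> Cov_minus le U" and U: "last p \<le> U"
  assumes "T \<subseteq> schedules" "path u" "last u \<le> last p" "\<forall>c<N. \<exists>x\<in>set u. known T c x"
  shows "last u \<le> Sup {reach p a J |R a J. robust A R a J}"
  using assms(3-)
proof (induction "weight schedules - weight T" arbitrary: T u rule: less_induct)
  case less
  let ?G = "Sup {reach p a J |R a J. robust A R a J}"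
  have "lands_in u U" using less.prems(3) U by (simp add: lands_in_def)
  then obtain Q where Q: "local_past_refinement le u Q" "\<forall>q\<in>Q. inhabits q A"
    using A less.prems(2) unfolding Cov_minus_def by blast
  have "last q \<le> ?G" if q_in: "q \<in> Q" for q
  proof -
    have q: "path q" "refines q (rst u (last q))" "last q \<le> last u"
      using Q(1) q_in Sup_upper[of "last q" "last ` Q"] by (auto simp: local_past_refinement_def)
    have "\<exists>i<length q. known T c (q ! i)" if c: "c < N" for c
    proof -
      obtain j where j: "j < length u" "known T c (u ! j)"
        using less.prems(4) c by (metis in_set_conv_nth)
      then obtain i where "i < length q" "q ! i \<le> rst u (last q) ! j"
        using q(2) by (auto simp: refines_def)
      then show ?thesis
        using known_mono[OF j(2)] rst_le[OF j(1) q(3)] order_trans by blast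
    qed
    then obtain m where m: "\<forall>c<N. m c < length q \<and> known T c (q ! m c)" by metis
    obtain n where n: "n < length q" "q ! n \<le> A"
      using Q(2) q_in by (auto simp: inhabits_def)
    \<comment> \<open>Every index from \<open>k\<close> on is visited after \<open>n\<close>; those below \<open>k\<close> are
      revisited in order on the way to \<open>m (k - 1)\<close>.\<close>
    define k where "k = (LEAST k. \<forall>c. k \<le> c \<and> c < N \<longrightarrow> n \<le> m c)"
    have k_le: "k \<le> N" unfolding k_def by (rule Least_le) simp
    have k: "\<forall>c. k \<le> c \<and> c < N \<longrightarrow> n \<le> m c"
      unfolding k_def by (rule LeastI[of _ N]) simp
    have k_pred: "m (k - 1) < n" if "k > 0"
    proof -
      have "\<not> (\<forall>c. k - 1 \<le> c \<and> c < N \<longrightarrow> n \<le> m c)"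
        using that not_less_Least[of "k - 1" "\<lambda>k. \<forall>c. k \<le> c \<and> c < N \<longrightarrow> n \<le> m c"]
        unfolding k_def by simp
      then obtain c where "k - 1 \<le> c" "c < N" "m c < n" by auto
      moreover from this have "c = k - 1" using k by (cases "k \<le> c") auto
      ultimately show ?thesis by simp
    qed
    \<comment> \<open>The schedule is the order in which \<open>q\<close> itself visits the indices
      from \<open>k\<close> on.\<close>
    define J where "J = sort_key m [k..<N]"
    have J: "sorted (map m J)" "set J = {k..<N}" "distinct J"
      by (auto simp: J_def)
    show "last q \<le> ?G"
    proof (cases "all_ready q m J")
      case True
      \<comment> \<open>For \<open>k = 0\<close> the truncated \<open>k - 1\<close> is harmless, as
        \<open>R\<close> is then empty.\<close>
      define R where "R = rst (take k p) (q ! m (k - 1))"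
      have len_R: "length R = k" using k_le length_p by (simp add: R_def)
      have visit: "\<forall>c\<in>set J. n \<le> m c \<and> m c < length q" using J(2) k m by auto
      have last_le: "last q \<le> last p" using q(3) less.prems(3) by simp
      have "path (R @ [q ! n]) \<and> (\<forall>c<length R. R ! c \<le> p ! c)"
      proof (cases k)
        case 0
        then show ?thesis using q(1) n len_R by (simp add: path_Cons is_path_def)
      next
        case (Suc l)
        define P where "P = take (Suc l) p"
        have P: "length P = Suc l" "P \<noteq> []" "path P" "\<And>c. c \<le> l \<Longrightarrow> P ! c = p ! c"
          using Suc k_le length_p path_take[OF path_p] by (auto simp: P_def)
        have l: "m l < length q" "known T l (q ! m l)" "m l < n"
          using m Suc k_le k_pred by auto
        have le: "q ! m l \<le> last P"
          using l(2) P by (simp add: known_def last_conv_nth)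
        have R: "R = rst P (q ! m l)" by (simp add: R_def P_def Suc)
        have "q ! m l \<noteq> bot" using q(1) l(1) by (simp add: is_path_def)
        then have "path R" unfolding R using path_rst P(3) le by blast
        moreover have "last R \<unlhd> q ! n"
          using path_le[OF q(1)] l(3) n(1) P(2) by (simp add: R last_rst)
        moreover have "path [q ! n]" using q(1) n by (simp add: path_Cons is_path_def)
        moreover have "R ! c \<le> p ! c" if "c < length R" for c
          using rst_le[OF _ le, of c] that P by (simp add: R)
        ultimately show ?thesis by (simp add: path_append)
      qed
      then have "robust A R (q ! n) J"
        using k_le J(2) n len_R
          follow_from[OF q(1) last_le True J(1) visit n(1)]
        by (simp add: robust_def)
      then have "reach p (q ! n) J \<le> ?G" by (intro Sup_upper) blast
      moreover have "last q \<le> reach p (q ! n) J"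
        by (rule reach_from[OF q(1) last_le True J(1) visit n(1) order_refl])
      ultimately show ?thesis by (rule order_trans[rotated])
    next
      case False
      then obtain J' g K where split: "J = J' @ g # K" "all_ready q m K"
          and g: "\<not> q ! m g \<le> ready p (g # K)"
        using not_all_ready by blast
      have gN: "g < N" "set K \<subseteq> {..<N}" "distinct K"
        using J(2,3) split(1) by auto
      have g_le: "q ! m g \<le> p ! g" using m gN by (simp add: known_def)
      \<comment> \<open>An empty remainder cannot fail, because \<open>p\<close> itself supplies the
        run to the endpoint.\<close>
      have "K \<noteq> []"
      proof
        assume "K = []"
        then have "low p K = N" using low_in[of K] by simp
        then have "q ! m g \<le> ready p (g # K)"
          using g_le run_path[OF gN(1)] \<open>K = []\<close> by simp
        then show False using g by simp
      qed
      then obtain b K'' where K_eq: "K = b # K''" by (cases K) auto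
      have K: "K \<in> schedules" using gN \<open>K \<noteq> []\<close> by (simp add: schedules_def)
      have b: "q ! m b \<le> ready p K" using split(2) K_eq by simp
      have mg: "m g \<le> m b" "m b < length q"
        using J(1) split(1) K_eq m gN by (auto simp: sorted_append)
      have "q ! m g \<le> dn (q ! m b)" by (intro le_dn path_le[OF q(1) mg])
      then have g_dn: "q ! m g \<le> dn (ready p K)" using dn_mono[OF b] order_trans by blast
      \<comment> \<open>From an index not below \<open>low p K\<close>, \<open>run_to\<close> is
        just \<open>dn\<close>, and \<open>g_dn\<close> already provides that.\<close>
      have g_less: "g < low p K"
      proof (rule ccontr)
        assume "\<not> g < low p K"
        then have "q ! m g \<le> ready p (g # K)"
          using g_le g_dn by (simp add: run_to.simps[of p g])
        then show False using g by simp
      qed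
      have "K \<notin> T"
        using m gN(1) g g_less g_le unfolding known_def by auto
      \<comment> \<open>Among the indices from \<open>low p K\<close> on, \<open>s\<close> is one
        that \<open>q\<close> visits first, as \<open>known_restart\<close> requires.\<close>
      obtain s where s: "low p K \<le> s \<and> s < N" "\<forall>c. low p K \<le> c \<and> c < N \<longrightarrow> m s \<le> m c"
        using ex_has_least_nat[of "\<lambda>c. low p K \<le> c \<and> c < N" "low p K" m] low_schedule(1)[OF K]
        by blast
      define T' where "T' = insert K {K' \<in> T. low p K \<le> low p K'}"
      define v where "v = rst (take (Suc s) p) (q ! m s) @ drop (m s) q"
      have v: "path v" "last v = last q" "\<forall>c<N. \<exists>x\<in>set v. known T' c x"
        using known_restart[OF less.prems(1) q(1) m K _ _ _ s(2)] s(1) b K_eq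
        unfolding v_def T'_def by auto
      have T': "T' \<subseteq> schedules" using K less.prems(1) by (auto simp: T'_def)
      have "weight T < weight T'"
        unfolding T'_def by (rule weight_less[OF less.prems(1) K \<open>K \<notin> T\<close>])
      then have "weight schedules - weight T' < weight schedules - weight T"
        using weight_le[OF T'] by simp
      moreover have "last v \<le> last p" using v(2) q(3) less.prems(3) by (simp add: order_trans)
      ultimately have "last v \<le> ?G"
        using less.hyps[OF _ T' v(1) _ v(3)] by blast
      then show ?thesis using v(2) by simp
    qed
  qed
  then have "Sup (last ` Q) \<le> ?G" by (auto intro: Sup_least)
  then show ?case using Q(1) by (simp add: local_past_refinement_def)
qed

section \<open>The topology\<close>

text \<open>Indices below \<open>length R\<close> are visited by \<open>s\<close>, those in
  \<open>J\<close> by \<open>follow\<close>, and the last one by the endpoint. The restriction is to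
  the endpoint of \<open>t\<close>, so the visits of \<open>s\<close> must first be shown to reach
  it through \<open>J\<close>.\<close>

lemma extend_refinement:
  assumes R: "robust A R a J" and V: "V \<le> a"
    and s: "path s" "last s \<le> a" "refines s (rst (rst (R @ [a]) V) (last s))"
  defines "t \<equiv> s @ follow p (last s) J"
  shows "path t \<and> last t = reach p (last s) J \<and> refines t (rst p (last t))"
proof -
  define W where "W = reach p (last s) J"
  define k where "k = length R"
  have J: "set J = {k..<N}" "k \<le> N" and R_le: "\<And>c. c < k \<Longrightarrow> R ! c \<le> p ! c"
    using R by (auto simp: robust_def k_def)
  have s_le: "last s \<le> dn (hd (follow p (last s) J))"
    using R s(2) by (simp add: robust_def)
  then have le: "last s \<unlhd> hd (follow p (last s) J)" by (rule le_hd_follow)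
  have "last s \<noteq> bot" using s(1) by (auto simp: is_path_def last_conv_nth)
  then have "hd (follow p (last s) J) \<noteq> bot" using le bot_right by metis
  then have "path t"
    unfolding t_def using path_append[OF s(1) path_follow le] by simp
  moreover have last_t: "last t = W" by (simp add: t_def last_follow W_def)
  moreover have "\<exists>x\<in>set t. x \<le> rst p W ! c" if c: "c \<le> N" for c
  proof -
    consider "c < k" | "k \<le> c" "c < N" | "c = N" using c by linarith
    then show ?thesis
    proof cases
      case 1
      define S where "S = rst (rst (R @ [a]) V) (last s)"
      have S_k: "S ! k = last s"
        using rst_last[of "rst (R @ [a]) V" "last s"] by (simp add: S_def k_def)
      \<comment> \<open>\<open>S ! d\<close> lies in \<open>p ! d\<close> via \<open>R\<close>;
        descending from \<open>k\<close>, it also reaches the next step of the restriction of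
        \<open>p\<close>.\<close>
      have S_step: "S ! d \<le> rst p W ! d" if "d < k" "S ! Suc d \<le> dn (rst p W ! Suc d)" for d
      proof -
        have eq: "S ! d = inf (rst (R @ [a]) V ! d) (dn (S ! Suc d))"
          unfolding S_def using that(1) by (intro rst_nth) (simp add: k_def)
        have "rst (R @ [a]) V ! d \<le> (R @ [a]) ! d"
          using V that(1) by (intro rst_le) (simp_all add: k_def)
        also have "(R @ [a]) ! d = R ! d" using that(1) by (simp add: nth_append k_def)
        also have "R ! d \<le> p ! d" using R_le that(1) .
        finally have "S ! d \<le> p ! d" unfolding eq by (rule le_infI1)
        moreover have "S ! d \<le> dn (rst p W ! Suc d)"
          unfolding eq using dn_trans[OF order_refl that(2)] by (rule le_infI2)
        moreover have "rst p W ! d = inf (p ! d) (dn (rst p W ! Suc d))"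
          using that(1) J(2) length_p by (intro rst_nth) simp
        ultimately show ?thesis by simp
      qed
      have S_dn: "S ! d \<le> dn (rst p W ! d)" if "d \<le> k" for d
        using that
      proof (induction rule: inc_induct)
        case base
        have "hd (follow p (last s) J) \<le> dn (rst p W ! k)"
        proof (rule order_trans[OF hd_follow_le])
          \<comment> \<open>Either \<open>k\<close> is scheduled in \<open>J\<close>, or
            \<open>k = N\<close> and \<open>J\<close> is empty.\<close>
          have "k \<in> insert N (set J)" "set J \<subseteq> {..<N}" using J by auto
          then show "inf (ready p J) (up (last s)) \<le> dn (rst p W ! k)"
            using ready_visits[of J "last s" W] by (auto simp: W_def)
        qed
        then show ?case unfolding S_k by (rule dn_trans[OF s_le])
      next
        case (step d)
        then show ?case using order_trans[OF S_step dn_ext] by simp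
      qed
      have "S ! c \<le> rst p W ! c" using S_step S_dn[of "Suc c"] 1 by simp
      moreover have "\<exists>x\<in>set s. x \<le> S ! c"
        using s(3) 1 by (simp add: refines_iff S_def k_def)
      ultimately show ?thesis unfolding t_def by (auto intro: order_trans)
    next
      case 2
      then have "set J \<subseteq> {..<N}" "c \<in> set J" using J(1) by auto
      then show ?thesis
        using follow_visits[of J "last s" W c] by (auto simp: t_def W_def)
    next
      case 3
      have "last t \<in> set t" by (simp add: t_def)
      then show ?thesis using 3 last_t rst_N by auto
    qed
  qed
  ultimately show ?thesis by (simp add: refines_iff length_p W_def less_Suc_eq_le)
qed

end

section \<open>Transitivity, maximality and stability of the causal coverage\<close>

lemma reach_bot: "reach p bot K = bot"
  using reach_Sup[of p "{}" K] by simp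

text \<open>The coverings \<open>C\<close> are allowed to be smaller than \<open>B\<close> because
  \<open>B\<close> itself need not lie below \<open>dn V\<close>.\<close>

lemma Cov_minus_transitive:
  assumes S: "Sup S \<in> Cov_minus le U"
    and C: "\<And>V. V \<in> S \<Longrightarrow> \<exists>C\<in>Cov_minus le V. C \<le> B"
    and B: "B \<le> dn U"
  shows "B \<in> Cov_minus le U"
proof -
  have "\<exists>Q. local_past_refinement le p Q \<and> (\<forall>q\<in>Q. inhabits q B)"
    if p: "path p" "last p \<le> U" for p
  proof -
    \<comment> \<open>All extensions of all robust stages at once; their endpoints join to
      \<open>last p\<close> by \<open>robust_cover\<close> and \<open>reach_le\<close>.\<close>
    define Q where "Q = {s @ follow p (last s) J |R a J V s. robust p (Sup S) R a J \<and> V \<le> a \<and>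
      path s \<and> last s \<le> a \<and> refines s (rst (rst (R @ [a]) V) (last s)) \<and> inhabits s B}"
    have Q: "path t \<and> refines t (rst p (last t)) \<and> last t \<le> last p \<and> inhabits t B" if t_in: "t \<in> Q" for t
    proof -
      obtain R a J V s where t: "t = s @ follow p (last s) J" "robust p (Sup S) R a J" "V \<le> a"
          "path s" "last s \<le> a" "refines s (rst (rst (R @ [a]) V) (last s))" "inhabits s B"
        using t_in unfolding Q_def by blast
      have "inhabits t B"
        using t(7) unfolding inhabits_iff t(1) by auto
      then show ?thesis
        using extend_refinement[OF p(1) t(2-6)] reach_le_last unfolding t(1)
        by (simp add: last_follow)
    qed
    \<comment> \<open>\<open>reach_Sup\<close> is used twice: to cut \<open>a\<close> along
      \<open>S\<close>, and to cut each piece \<open>inf a V\<close> into the endpoints of its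
      refinement.\<close>
    have reach_le: "reach p a J \<le> Sup (last ` Q)" if R: "robust p (Sup S) R a J" for R a J
    proof -
      have "a \<le> Sup S" and path_R: "path (R @ [a])" using R p(1) by (auto simp: robust_def)
      then have a: "a = Sup (inf a ` S)"
        by (simp add: inf_Sup_frame[symmetric] inf.absorb1)
      have "reach p (inf a V) J \<le> Sup (last ` Q)" if V: "V \<in> S" for V
      proof (cases "inf a V = bot")
        case True
        then show ?thesis by (simp add: reach_bot)
      next
        case False
        define r where "r = rst (R @ [a]) (inf a V)"
        have "path r" unfolding r_def using path_R False by (intro path_rst) auto
        moreover have last_r: "last r = inf a V" by (simp add: r_def last_rst)
        ultimately obtain C Q' where Q': "C \<le> B" "local_past_refinement le r Q'" "\<forall>s\<in>Q'. inhabits s C"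
          using C[OF V] unfolding Cov_minus_def lands_in_def by fastforce
        have "reach p (last s) J \<le> Sup (last ` Q)" if s: "s \<in> Q'" for s
        proof -
          have "last s \<le> Sup (last ` Q')" using s by (intro Sup_upper) simp
          then have "last s \<le> a"
            using Q'(2) last_r by (simp add: local_past_refinement_def)
          moreover have "path s" "refines s (rst r (last s))"
            using Q'(2) s by (auto simp: local_past_refinement_def)
          moreover have "inhabits s B"
            using Q'(1,3) s unfolding inhabits_iff by (meson order_trans)
          ultimately have "s @ follow p (last s) J \<in> Q"
            unfolding Q_def r_def using R inf.cobounded1 by blast
          then have "last (s @ follow p (last s) J) \<le> Sup (last ` Q)" by (intro Sup_upper imageI)
          then show ?thesis by (simp add: last_follow)
        qed
        then have "Sup ((\<lambda>X. reach p X J) ` last ` Q') \<le> Sup (last ` Q)"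
          by (auto intro: Sup_least)
        then show ?thesis
          using Q'(2) last_r by (simp add: reach_Sup[symmetric] local_past_refinement_def)
      qed
      then have "Sup ((\<lambda>X. reach p X J) ` inf a ` S) \<le> Sup (last ` Q)"
        by (auto intro: Sup_least)
      then show ?thesis using a by (simp add: reach_Sup[symmetric])
    qed
    \<comment> \<open>With nothing learned yet, \<open>p\<close> itself is a valid starting
      path.\<close>
    have "\<forall>c<length p - Suc 0. \<exists>x\<in>set p. known p {} c x"
      using p(1) by (auto simp: known_def intro!: bexI[of _ "p ! _"])
    then have "last p \<le> Sup {reach p a J |R a J. robust p (Sup S) R a J}"
      using robust_cover[OF p(1) S p(2), of "{}" p] p(1) by simp
    also have "\<dots> \<le> Sup (last ` Q)" using reach_le by (auto intro: Sup_least)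
    finally have "Sup (last ` Q) = last p"
      using Q by (intro antisym Sup_least) auto
    then show ?thesis using Q by (auto simp: local_past_refinement_def)
  qed
  then show ?thesis using B by (simp add: Cov_minus_def lands_in_def)
qed

lemma Cov_minus_dn: "dn U \<in> Cov_minus le U"
proof -
  have "local_past_refinement le p {p} \<and> inhabits p (dn U)" if p: "path p" "last p \<le> U" for p
  proof -
    have "refines p (rst p (last p))"
      using rst_last_id[OF p(1)] by (auto simp: refines_def)
    moreover have "last p \<in> set p" using p(1) by (simp add: is_path_def)
    then have "inhabits p (dn U)"
      using order_trans[OF p(2) dn_ext] by (auto simp: inhabits_iff)
    ultimately show ?thesis using p(1) by (simp add: local_past_refinement_def)
  qed
  then show ?thesis unfolding Cov_minus_def lands_in_def by blast
qed

text \<open>The refinement given by \<open>A\<close> serves again: each step of \<open>q\<close>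
  lies below \<open>dn (last q)\<close>, hence below \<open>dn D\<close>.\<close>

lemma Cov_minus_stable:
  assumes A: "A \<in> Cov_minus le U" and D: "D \<le> U"
  shows "inf A (dn D) \<in> Cov_minus le D"
proof -
  have "\<exists>Q. local_past_refinement le p Q \<and> (\<forall>q\<in>Q. inhabits q (inf A (dn D)))"
    if p: "path p" "last p \<le> D" for p
  proof -
    have "lands_in p U" using p(2) D by (simp add: lands_in_def)
    then obtain Q where Q: "local_past_refinement le p Q" "\<forall>q\<in>Q. inhabits q A"
      using A p(1) unfolding Cov_minus_def by blast
    have "inhabits q (inf A (dn D))" if q: "q \<in> Q" for q
    proof -
      obtain n where n: "n < length q" "q ! n \<le> A" using Q(2) q by (auto simp: inhabits_def)
      have "path q" "last q \<le> last p"
        using Q(1) q Sup_upper[of "last q" "last ` Q"] by (auto simp: local_past_refinement_def)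
      then have "q ! n \<le> dn (last q)" "last q \<le> D"
        using n(1) p(2) by (auto intro: le_dn path_le_last)
      then have "q ! n \<le> dn D" using dn_mono order_trans by blast
      then show ?thesis using n by (auto simp: inhabits_def)
    qed
    then show ?thesis using Q(1) by blast
  qed
  then show ?thesis by (simp add: Cov_minus_def lands_in_def)
qed

section \<open>Translation to sieves on the category of opens\<close>

lemma sieve_opens_iff:
  "sieve opens_category U R \<longleftrightarrow>
    (\<forall>(V, U')\<in>R. V \<le> U' \<and> U' = U) \<and> (\<forall>V W. (V, U) \<in> R \<and> W \<le> V \<longrightarrow> (W, U) \<in> R)"
  unfolding sieve_def opens_category_def by fastforce

lemma pullback_opens:
  "pullback_sieve opens_category h R = {(V, D). V \<le> D \<and> D = fst h \<and> (V, snd h) \<in> R}"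
  unfolding pullback_sieve_def opens_category_def by auto

lemma endofunctor_mult_opens:
  "endofunctor_mult opens_category dn (down_cone_arr le) (\<lambda>U. Id opens_category (dn U))"
  by unfold_locales (auto simp: opens_category_def down_cone_arr_def dn_dn intro: dn_mono)

lemma J_minus_iff:
  "R \<in> J_minus le U \<longleftrightarrow> sieve opens_category (dn U) R \<and> Sup (fst ` R) \<in> Cov_minus le U"
  by (simp add: J_minus_def opens_category_def)

lemma J_minus_stable:
  assumes D: "D \<le> U" and S: "S \<in> J_minus le U"
  shows "pullback_sieve opens_category (dn D, dn U) S \<in> J_minus le D"
proof -
  let ?P = "pullback_sieve opens_category (dn D, dn U) S"
  have sv: "sieve opens_category (dn U) S" and cov: "Sup (fst ` S) \<in> Cov_minus le U"
    using S by (simp_all add: J_minus_iff)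
  have "sieve opens_category (dn D) ?P"
    using sv unfolding pullback_opens sieve_opens_iff by (auto intro: order_trans)
  \<comment> \<open>By distributivity it is enough that each domain in \<open>S\<close>, cut down to
    \<open>dn D\<close>, is again a domain in the pullback.\<close>
  moreover have "Sup (fst ` ?P) = inf (Sup (fst ` S)) (dn D)"
  proof (rule antisym)
    show "Sup (fst ` ?P) \<le> inf (Sup (fst ` S)) (dn D)"
      by (rule Sup_least) (force simp: pullback_opens intro: Sup_upper)
    have "inf (dn D) V \<le> Sup (fst ` ?P)" if "V \<in> fst ` S" for V
    proof (rule Sup_upper)
      have "(V, dn U) \<in> S" using that sv by (force simp: sieve_opens_iff)
      then have "(inf (dn D) V, dn U) \<in> S" using sv inf.cobounded2 unfolding sieve_opens_iff by blast
      then have "(inf (dn D) V, dn D) \<in> ?P" by (simp add: pullback_opens)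
      then show "inf (dn D) V \<in> fst ` ?P" by (rule image_eqI[rotated]) simp
    qed
    then have "Sup (inf (dn D) ` fst ` S) \<le> Sup (fst ` ?P)" by (auto intro: Sup_least)
    then show "inf (Sup (fst ` S)) (dn D) \<le> Sup (fst ` ?P)"
      by (simp add: inf_Sup_frame inf.commute[of _ "dn D"])
  qed
  ultimately show ?thesis
    using Cov_minus_stable[OF cov D] by (simp add: J_minus_iff)
qed

text \<open>The domains of each pulled-back sieve are among those of \<open>R\<close>, so its join
  is a covering below the join of \<open>R\<close>.\<close>

lemma J_minus_transitive:
  assumes S: "S \<in> J_minus le U" and R: "sieve opens_category (dn U) R"
    and pb: "\<And>V. (V, dn U) \<in> S \<Longrightarrow> pullback_sieve opens_category (dn V, dn U) R \<in> J_minus le V"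
  shows "R \<in> J_minus le U"
proof -
  have sv: "sieve opens_category (dn U) S" and cov: "Sup (fst ` S) \<in> Cov_minus le U"
    using S by (simp_all add: J_minus_iff)
  have "Sup (fst ` R) \<in> Cov_minus le U"
  proof (rule Cov_minus_transitive[OF cov])
    fix V assume "V \<in> fst ` S"
    then have "(V, dn U) \<in> S" using sv by (force simp: sieve_opens_iff)
    then have "Sup (fst ` pullback_sieve opens_category (dn V, dn U) R) \<in> Cov_minus le V"
      using pb by (simp add: J_minus_iff)
    moreover have "fst ` pullback_sieve opens_category (dn V, dn U) R \<subseteq> fst ` R"
      by (force simp: pullback_opens)
    ultimately show "\<exists>C\<in>Cov_minus le V. C \<le> Sup (fst ` R)"
      using Sup_subset_mono by blast
  next
    show "Sup (fst ` R) \<le> dn U"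
      using R by (auto simp: sieve_opens_iff intro!: Sup_least)
  qed
  then show ?thesis using R by (simp add: J_minus_iff)
qed

lemma down_Grothendieck_topology_J_minus: "down_Grothendieck_topology le (J_minus le)"
  unfolding down_Grothendieck_topology_def
proof (intro T_Grothendieck_topology.intro T_Grothendieck_topology_axioms.intro
    endofunctor_mult_opens)
  fix U S assume "S \<in> J_minus le U"
  then show "sieve opens_category (dn U) S" by (simp add: J_minus_def)
next
  fix U :: 'a
  have max: "max_sieve opens_category (dn U) = {(V, D). V \<le> D \<and> D = dn U}"
    by (auto simp: max_sieve_def opens_category_def)
  have "fst ` max_sieve opens_category (dn U) = {..dn U}"
    unfolding max by force
  moreover have "sieve opens_category (dn U) (max_sieve opens_category (dn U))"
    unfolding max sieve_opens_iff by auto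
  ultimately show "max_sieve opens_category (dn U) \<in> J_minus le U"
    using Cov_minus_dn by (simp add: J_minus_iff Sup_atMost)
next
  fix h :: "'a \<times> 'a" and S
  assume "h \<in> Arr opens_category" "S \<in> J_minus le (Cod opens_category h)"
  then show "pullback_sieve opens_category (down_cone_arr le h) S \<in> J_minus le (Dom opens_category h)"
    using J_minus_stable[of "fst h" "snd h" S]
    by (auto simp: down_cone_arr_def opens_category_def)
next
  fix U S R
  assume S: "S \<in> J_minus le U" and R: "sieve opens_category (dn U) R"
    and pb: "\<And>h. h \<in> S \<Longrightarrow>
      pullback_sieve opens_category
        (Comp opens_category (Id opens_category (dn U)) (down_cone_arr le h)) R
      \<in> J_minus le (Dom opens_category h)"
  show "R \<in> J_minus le U"
  proof (rule J_minus_transitive[OF S R])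
    fix V assume "(V, dn U) \<in> S"
    from pb[OF this] show "pullback_sieve opens_category (dn V, dn U) R \<in> J_minus le V"
      by (simp add: down_cone_arr_def opens_category_def)
  qed
qed

end

theorem theorem6p5:
  fixes le :: "'a::frame \<Rightarrow> 'a \<Rightarrow> bool"
  assumes "parallel_ordered_locale le"
    and "cones_preserve_joins le"
  shows "down_Grothendieck_topology le (J_minus le)"
proof -
  interpret cone_locale le
    by (intro cone_locale.intro cone_locale_axioms.intro assms)
  show ?thesis by (rule down_Grothendieck_topology_J_minus)
qed

end
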